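(* $H_4(q)=q(q+1)$ for every integer $q\ge2$, and $H_4(1)=3$.
   Context: An ordered real $m$-alphabet is a strictly increasing tuple $T=(t_0<\cdots<t_{m-1})$ of real numbers. For an integer $q\ge1$, an order-preserving integer $q$-model of $T$ is a strictly increasing tuple of integers $S=(s_0<\cdots<s_{m-1})$ such that for every $1\le h\le q$ and all index lists $i_1,\dots,i_h$, $j_1,\dots,j_h$ (repetitions allowed), $\sum_{\nu=1}^h t_{i_\nu}=\sum_{\nu=1}^h t_{j_\nu}$ if and only if $\sum_{\nu=1}^h s_{i_\nu}=\sum_{\nu=1}^h s_{j_\nu}$. The diameter of $S$ is $s_{m-1}-s_0$. $H_m(q)$ denotes the least integer $D$ such that every ordered real $m$-alphabet has an order-preserving integer $q$-model of diameter at most $D$. *)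

theory Defs
  imports Complex_Main
begin

text \<open>Tuples are lists, indexed from 0; an index list is a list of positions.\<close>

definition ordered_alphabet :: "nat \<Rightarrow> real list \<Rightarrow> bool" where
  "ordered_alphabet m T \<longleftrightarrow> length T = m \<and> sorted_wrt (<) T"

definition index_list :: "nat \<Rightarrow> nat \<Rightarrow> nat list \<Rightarrow> bool" where
  "index_list m h I \<longleftrightarrow> length I = h \<and> (\<forall>i \<in> set I. i < m)"

definition integer_model :: "nat \<Rightarrow> real list \<Rightarrow> int list \<Rightarrow> bool" where
  "integer_model q T S \<longleftrightarrow>
     length S = length T \<and> sorted_wrt (<) S \<and>
     (\<forall>h. 1 \<le> h \<and> h \<le> q \<longrightarrow>
       (\<forall>I J. index_list (length T) h I \<and> index_list (length T) h J \<longrightarrow>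
          ((\<Sum>\<nu><h. T ! (I ! \<nu>)) = (\<Sum>\<nu><h. T ! (J ! \<nu>)) \<longleftrightarrow>
           (\<Sum>\<nu><h. S ! (I ! \<nu>)) = (\<Sum>\<nu><h. S ! (J ! \<nu>)))))"

text \<open>Meaningful for nonempty tuples only.\<close>

definition diameter :: "int list \<Rightarrow> int" where
  "diameter S = last S - hd S"

definition H :: "nat \<Rightarrow> nat \<Rightarrow> int" where
  "H m q = (LEAST D. \<forall>T. ordered_alphabet m T \<longrightarrow>
                       (\<exists>S. integer_model q T S \<and> diameter S \<le> D))"

end

theory Submission
  imports Defs
begin

text \<open>
  Pass to the gaps \<open>a, b, c > 0\<close> of the alphabet.  Counting index occurrences turns an additive
  coincidence of length at most \<open>q\<close> into an integer relation \<open>u a + v b + w c = 0\<close> with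
  \<open>|u| + |u - v| + |v - w| + |w| \<le> 2 q\<close>; then \<open>0, u, v, w\<close> lie in an interval of length \<open>q\<close>.
  Hence for two relations \<open>r, s\<close> the coordinate sum of the cross product \<open>r \<times> s\<close> is twice the area
  of a triangle in a square of side \<open>q\<close>, so at most \<open>q\<^sup>2\<close> in absolute value.

  Upper bound.  If there are two independent relations \<open>r, s\<close>, then \<open>\<plusminus>(r \<times> s)\<close> is a model.  If there
  is no relation, \<open>(1, q\<^sup>2 - 1, q)\<close> is one.  If all relations are multiples of \<open>r\<close>, choose an extreme
  ray \<open>E\<close> of the nonnegative cone of \<open>r\<^sup>\<bottom>\<close> and an integral \<open>S\<close> with \<open>S \<times> E = \<plusminus>r\<close>; adding multiples
  of \<open>E\<close>, whose coordinate sum is at most \<open>q\<close>, one may take the coordinate sum of \<open>S\<close> in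
  \<open>(q\<^sup>2, q\<^sup>2 + q]\<close>.  A relation \<open>s\<close> of \<open>S\<close> satisfies \<open>r \<times> s = \<plusminus>(E \<cdot> s) S\<close>, and the area bound forces
  \<open>E \<cdot> s = 0\<close>, so \<open>s\<close> is a multiple of \<open>r\<close>.

  Lower bound.  The gaps \<open>1, q, (q - 1)(q + 1)\<close> force integer gaps \<open>A, B, (q - 1)(A + B)\<close>, and
  \<open>A + B \<le> q\<close> is impossible because then \<open>(B, -A, 0)\<close> would be a relation of the model only.
\<close>

section \<open>Areas of triangles in a square\<close>

text \<open>Up to sign, the determinant is twice the area of the triangle with vertices
  \<open>(0, 0)\<close>, \<open>(p1, s1)\<close>, \<open>(p2, s2)\<close>.\<close>

lemma det_bound_in_square:
  fixes q p1 p2 s1 s2 :: int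
  assumes "\<bar>p1\<bar> \<le> q" "\<bar>p2\<bar> \<le> q" "\<bar>p1 - p2\<bar> \<le> q"
    and "\<bar>s1\<bar> \<le> q" "\<bar>s2\<bar> \<le> q" "\<bar>s1 - s2\<bar> \<le> q"
  shows "\<bar>p1 * s2 - p2 * s1\<bar> \<le> q * q"
proof -
  have q: "0 \<le> q" using assms by linarith
  have tri: "\<bar>p1 * s2 - p2 * s1\<bar> \<le> \<bar>p1\<bar> * \<bar>s2\<bar> + \<bar>p2\<bar> * \<bar>s1\<bar>"
    by (metis abs_mult abs_triangle_ineq4)
  \<comment> \<open>If \<open>p1\<close> and \<open>p2\<close> have opposite signs, their absolute
    values add up to that of \<open>p1 - p2\<close>; likewise for \<open>s1\<close> and
    \<open>s2\<close>. Otherwise the two products in the determinant have the same sign.\<close>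
  consider "\<bar>p1\<bar> + \<bar>p2\<bar> \<le> q" | "\<bar>s1\<bar> + \<bar>s2\<bar> \<le> q"
    | "(0 \<le> p1 \<and> 0 \<le> p2 \<or> p1 \<le> 0 \<and> p2 \<le> 0) \<and> (0 \<le> s1 \<and> 0 \<le> s2 \<or> s1 \<le> 0 \<and> s2 \<le> 0)"
    using assms by linarith
  then show ?thesis
  proof cases
    case 1
    have "\<bar>p1\<bar> * \<bar>s2\<bar> + \<bar>p2\<bar> * \<bar>s1\<bar> \<le> \<bar>p1\<bar> * q + \<bar>p2\<bar> * q"
      using assms by (intro add_mono mult_left_mono) auto
    also have "\<dots> = (\<bar>p1\<bar> + \<bar>p2\<bar>) * q" by (simp add: algebra_simps)
    also have "\<dots> \<le> q * q" using 1 q by (intro mult_right_mono) auto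
    finally show ?thesis using tri by linarith
  next
    case 2
    have "\<bar>p1\<bar> * \<bar>s2\<bar> + \<bar>p2\<bar> * \<bar>s1\<bar> \<le> q * \<bar>s2\<bar> + q * \<bar>s1\<bar>"
      using assms by (intro add_mono mult_right_mono) auto
    also have "\<dots> = q * (\<bar>s1\<bar> + \<bar>s2\<bar>)" by (simp add: algebra_simps)
    also have "\<dots> \<le> q * q" using 2 q by (intro mult_left_mono) auto
    finally show ?thesis using tri by linarith
  next
    case 3
    have same_sign: "0 \<le> p1 * s2 \<and> 0 \<le> p2 * s1 \<or> p1 * s2 \<le> 0 \<and> p2 * s1 \<le> 0"
      using 3 by (auto simp: mult_nonneg_nonneg mult_nonpos_nonpos mult_nonneg_nonpos mult_nonpos_nonneg)
    have "\<bar>p1 * s2\<bar> \<le> q * q" "\<bar>p2 * s1\<bar> \<le> q * q"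
      unfolding abs_mult using assms q by (auto intro: mult_mono)
    then show ?thesis using same_sign by linarith
  qed
qed

text \<open>Unlike \<open>rel_size\<close> below, this bound is symmetric in the three coordinates,
  so the rank-one case can be treated up to a permutation.\<close>

definition near :: "int \<Rightarrow> int \<Rightarrow> int \<Rightarrow> int \<Rightarrow> bool" where
  "near q u v w \<longleftrightarrow> \<bar>u\<bar> \<le> q \<and> \<bar>v\<bar> \<le> q \<and> \<bar>w\<bar> \<le> q \<and> \<bar>u - v\<bar> \<le> q \<and> \<bar>v - w\<bar> \<le> q \<and> \<bar>u - w\<bar> \<le> q"

text \<open>The triangle now has vertices \<open>(u, u')\<close>, \<open>(v, v')\<close>,
  \<open>(w, w')\<close>; the first is translated to the origin.\<close>

lemma cross_sum_bound:
  assumes "near q u v w" "near q u' v' w'"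
  shows "\<bar>(v * w' - w * v') + (w * u' - u * w') + (u * v' - v * u')\<bar> \<le> q * q"
proof -
  have "\<bar>(v - u) * (w' - u') - (w - u) * (v' - u')\<bar> \<le> q * q"
    by (rule det_bound_in_square) (use assms in \<open>simp_all add: near_def abs_minus_commute\<close>)
  moreover have "(v - u) * (w' - u') - (w - u) * (v' - u')
      = (v * w' - w * v') + (w * u' - u * w') + (u * v' - v * u')"
    by (simp add: algebra_simps)
  ultimately show ?thesis by simp
qed

section \<open>Models when the relations have rank one or two\<close>

text \<open>For \<open>r = (x, - y, z)\<close> the extreme ray is \<open>E = (y', x', 0)\<close>,
  and the equations say that the cross product of \<open>(A, B, g)\<close> and \<open>E\<close> is
  \<open>- r\<close>.\<close>

lemma det_one_vector:
  fixes q x y z :: int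
  assumes "near q x (- y) z" "0 < x" "0 < y"
  obtains g x' y' A B where "0 < g" "x = g * x'" "y = g * y'" "0 < A" "0 < B"
    "A * x' - B * y' = - z" "q * q < A + B + g" "A + B + g \<le> q * q + q"
proof -
  define g where "g = gcd x y"
  define x' where "x' = x div g"
  define y' where "y' = y div g"
  have g: "0 < g" using assms by (simp add: g_def)
  have x: "x = g * x'" and y: "y = g * y'" by (simp_all add: g_def x'_def y'_def)
  have x': "0 < x'" and y': "0 < y'" using assms g x y by (metis zero_less_mult_pos)+
  have cop: "coprime x' y'"
    unfolding x'_def y'_def g_def using assms by (intro div_gcd_coprime) auto
  have xy: "x + y \<le> q" using assms by (auto simp: near_def)
  have gx: "g \<le> x" "x' \<le> x" using x x' g assms
    by (metis dvd_triv_left dvd_triv_right zdvd_imp_le)+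
  have gy: "g \<le> y" "y' \<le> y" using y y' g assms
    by (metis dvd_triv_left dvd_triv_right zdvd_imp_le)+
  obtain c d where cd: "c * x' + d * y' = 1"
    using cop by (metis bezout_int coprime_imp_gcd_eq_1)
  define n where "n = x' + y'"
  have n: "0 < n" "n \<le> q" using x' y' gx gy xy by (auto simp: n_def)
  \<comment> \<open>\<open>N\<close> is the largest admissible value of \<open>A + B\<close>. The
    Bezout solution \<open>(- z * c, z * d)\<close> is shifted by the largest multiple of
    \<open>(y', x')\<close> that respects it, so \<open>A + B\<close> misses \<open>N\<close> by
    less than \<open>n\<close>, which is at most \<open>q\<close>.\<close>
  define N where "N = q * q + q - g"
  define k where "k = (N - (- z * c + z * d)) div n"
  define A where "A = - z * c + k * y'"
  define B where "B = z * d + k * x'"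
  have eq: "A * x' - B * y' = - z"
  proof -
    have "A * x' - B * y' = - z * (c * x' + d * y')" by (simp add: A_def B_def algebra_simps)
    then show ?thesis using cd by simp
  qed
  have AB: "A + B = N - (N - (- z * c + z * d)) mod n"
    unfolding A_def B_def minus_mod_eq_mult_div [symmetric]
    using minus_mod_eq_mult_div[of "N - (- z * c + z * d)" n]
    by (simp add: k_def n_def algebra_simps)
  have le: "A + B + g \<le> q * q + q" and gt: "q * q < A + B + g"
    using AB n pos_mod_sign[of n "N - (- z * c + z * d)"] pos_mod_bound[of n "N - (- z * c + z * d)"]
    unfolding N_def by linarith+
  have "2 \<le> q" using xy assms by linarith
  then have "2 * q \<le> q * q" by (intro mult_right_mono) auto
  \<comment> \<open>As the absolute value of \<open>z\<close> is below \<open>q\<close>, a sum above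
    \<open>q\<close> makes both \<open>A\<close> and \<open>B\<close> positive.\<close>
  then have big: "q < A + B" using gt gx gy xy \<open>2 \<le> q\<close> by linarith
  have zy: "z < q" "- q < z" using assms by (auto simp: near_def)
  have "A + B \<le> (A + B) * y'" "A + B \<le> (A + B) * x'"
    using big x' y' \<open>2 \<le> q\<close> by (auto simp: mult_le_cancel_left1)
  moreover have "A * n = (A + B) * y' - z" "B * n = (A + B) * x' + z"
    using eq by (simp_all add: n_def algebra_simps)
  ultimately have "0 < A * n" "0 < B * n" using big zy by linarith+
  then have "0 < A" "0 < B" using n by (simp_all add: zero_less_mult_iff)
  with that g x y eq gt le show thesis by blast
qed

text \<open>The predicate \<open>P\<close> stands for the size bound read in permuted
  coordinates.\<close>

lemma rank_one_model:
  fixes t1 t2 t3 :: real and q x y z :: int and P :: "int \<Rightarrow> int \<Rightarrow> int \<Rightarrow> bool"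
  assumes P: "\<And>u v w. P u v w \<Longrightarrow> near q u v w"
    and r: "P x (- y) z" "0 < x" "0 < y" "x * t1 - y * t2 + z * t3 = 0"
    and multiples: "\<And>u v w. P u v w \<Longrightarrow> u * t1 + v * t2 + w * t3 = 0 \<Longrightarrow>
      u * - y = v * x \<and> u * z = w * x \<and> v * z = w * - y"
  shows "\<exists>A B C. 0 < A \<and> 0 < B \<and> 0 < C \<and> A + B + C \<le> q * q + q \<and>
    (\<forall>u v w. P u v w \<longrightarrow> (u * t1 + v * t2 + w * t3 = 0 \<longleftrightarrow> u * A + v * B + w * C = 0))"
proof -
  obtain g x' y' A B where S: "0 < g" "x = g * x'" "y = g * y'" "0 < A" "0 < B"
    "A * x' - B * y' = - z" "q * q < A + B + g" "A + B + g \<le> q * q + q"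
    using det_one_vector[OF P[OF r(1)] r(2,3)] by metis
  have z: "z = B * y' - A * x'" using S(6) by simp
  have "u * t1 + v * t2 + w * t3 = 0 \<longleftrightarrow> u * A + v * B + w * g = 0" if uvw: "P u v w" for u v w
  proof
    assume "u * t1 + v * t2 + w * t3 = 0"
    with multiples[OF uvw] have m: "v * x = - (u * y)" "w * x = u * z" by auto
    have "x * (u * A + v * B + w * g) = u * (x * A) + (v * x) * B + (w * x) * g"
      by (simp add: algebra_simps)
    also have "\<dots> = u * (x * A - y * B + z * g)"
      unfolding m by (simp add: algebra_simps)
    also have "x * A - y * B + z * g = 0"
      unfolding S(2,3) z by (simp add: algebra_simps)
    finally show "u * A + v * B + w * g = 0" using r(2) by simp
  next
    assume 0: "u * A + v * B + w * g = 0"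
    \<comment> \<open>\<open>e\<close> is the scalar product of \<open>E = (y', x', 0)\<close> with
      \<open>s = (u, v, w)\<close>. The facts \<open>e1\<close>, \<open>e2\<close>,
      \<open>e3\<close> say that the cross product of \<open>r\<close> and \<open>s\<close> is
      \<open>e\<close> times \<open>(A, B, g)\<close>.\<close>
    define e where "e = u * y' + v * x'"
    have wg: "w * g = - u * A - v * B" using 0 by simp
    have e1: "- y * w - z * v = A * e"
    proof -
      have "- y * w - z * v = - y' * (w * g) - z * v" using S(3) by simp
      then show ?thesis unfolding wg z e_def by (simp add: algebra_simps)
    qed
    have e2: "z * u - x * w = B * e"
    proof -
      have "z * u - x * w = z * u - x' * (w * g)" using S(2) by simp
      then show ?thesis unfolding wg z e_def by (simp add: algebra_simps)
    qed
    have e3: "x * v + y * u = g * e"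
      using S(2,3) by (simp add: e_def algebra_simps)
    have "\<bar>(- y * w - z * v) + (z * u - x * w) + (x * v + y * u)\<bar> \<le> q * q"
      using cross_sum_bound[OF P[OF r(1)] P[OF uvw]] by simp
    then have "\<bar>(A + B + g) * e\<bar> \<le> q * q"
      unfolding e1 e2 e3 by (simp add: algebra_simps)
    moreover have "A + B + g \<le> \<bar>(A + B + g) * e\<bar>" if "e \<noteq> 0"
      using that S unfolding abs_mult by (auto simp: mult_le_cancel_left1)
    ultimately have "e = 0" using S(7) by linarith
    then have m: "x * v = - (y * u)" "x * w = z * u" using e2 e3 by auto
    have "x * (u * t1 + v * t2 + w * t3)
        = u * (x * t1) + real_of_int (x * v) * t2 + real_of_int (x * w) * t3"
      by (simp add: algebra_simps)
    also have "\<dots> = u * (x * t1 - y * t2 + z * t3)"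
      unfolding m by (simp add: algebra_simps)
    finally show "u * t1 + v * t2 + w * t3 = 0" using r by simp
  qed
  then show ?thesis using S by blast
qed

text \<open>Both relations are orthogonal to \<open>(t1, t2, t3)\<close>, so their cross product is
  proportional to it. Hence the equivalence holds for all \<open>u\<close>, \<open>v\<close>,
  \<open>w\<close>, without a size bound.\<close>

lemma rank_two_model:
  fixes t1 t2 t3 :: real and q :: int
  assumes t: "0 < t1" "0 < t2" "0 < t3"
    and near: "near q x y z" "near q x' y' z'"
    and r: "x * t1 + y * t2 + z * t3 = 0" and r': "x' * t1 + y' * t2 + z' * t3 = 0"
    and indep: "\<not> (x' * y = y' * x \<and> x' * z = z' * x \<and> y' * z = z' * y)"
  shows "\<exists>A B C. 0 < A \<and> 0 < B \<and> 0 < C \<and> A + B + C \<le> q * q \<and>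
    (\<forall>u v w :: int. u * t1 + v * t2 + w * t3 = 0 \<longleftrightarrow> u * A + v * B + w * C = 0)"
proof -
  define n1 where "n1 = y * z' - z * y'"
  define n2 where "n2 = z * x' - x * z'"
  define n3 where "n3 = x * y' - y * x'"
  have p12: "n1 * t2 = n2 * t1"
  proof -
    have "n1 * t2 - n2 * t1 = z' * (x * t1 + y * t2 + z * t3) - z * (x' * t1 + y' * t2 + z' * t3)"
      by (simp add: n1_def n2_def algebra_simps)
    then show ?thesis using r r' by simp
  qed
  have p13: "n1 * t3 = n3 * t1"
  proof -
    have "n3 * t1 - n1 * t3 = y' * (x * t1 + y * t2 + z * t3) - y * (x' * t1 + y' * t2 + z' * t3)"
      by (simp add: n1_def n3_def algebra_simps)
    then show ?thesis using r r' by simp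
  qed
  have n1: "n1 \<noteq> 0"
  proof
    assume "n1 = 0"
    then have "n2 = 0" "n3 = 0" using p12 p13 t by auto
    with \<open>n1 = 0\<close> indep show False by (auto simp: n1_def n2_def n3_def algebra_simps)
  qed
  define A where "A = sgn n1 * n1"
  define B where "B = sgn n1 * n2"
  define C where "C = sgn n1 * n3"
  have A: "0 < A" using n1 by (simp add: A_def mult.commute abs_sgn[symmetric])
  have pB: "A * t2 = B * t1" and pC: "A * t3 = C * t1"
    using p12 p13 by (simp_all add: A_def B_def C_def)
  have "0 < B * t1" "0 < C * t1" using pB pC A t by (metis mult_pos_pos of_int_0_less_iff)+
  then have BC: "0 < B" "0 < C" using t by (simp_all add: zero_less_mult_iff)
  have "A + B + C = sgn n1 * (n1 + n2 + n3)" by (simp add: A_def B_def C_def algebra_simps)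
  then have "A + B + C \<le> \<bar>n1 + n2 + n3\<bar>" using n1 by (auto simp: sgn_if)
  also have "\<dots> \<le> q * q"
    using cross_sum_bound[OF near] by (simp add: n1_def n2_def n3_def)
  finally have le: "A + B + C \<le> q * q" .
  have "u * t1 + v * t2 + w * t3 = 0 \<longleftrightarrow> u * A + v * B + w * C = 0" for u v w :: int
  proof -
    have "A * (u * t1 + v * t2 + w * t3) = u * (A * t1) + v * (A * t2) + w * (A * t3)"
      by (simp add: algebra_simps)
    also have "\<dots> = t1 * real_of_int (u * A + v * B + w * C)"
      unfolding pB pC by (simp add: algebra_simps)
    finally have eq: "A * (u * t1 + v * t2 + w * t3) = t1 * real_of_int (u * A + v * B + w * C)" .
    have "u * t1 + v * t2 + w * t3 = 0 \<longleftrightarrow> A * (u * t1 + v * t2 + w * t3) = 0"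
      using A by simp
    also have "\<dots> \<longleftrightarrow> real_of_int (u * A + v * B + w * C) = 0"
      unfolding eq using t by simp
    finally show ?thesis by (simp only: of_int_eq_0_iff)
  qed
  then show ?thesis using A BC le by blast
qed

section \<open>Relations of bounded size between three gaps\<close>

text \<open>For two index lists of equal length, \<open>- u\<close>, \<open>u - v\<close>,
  \<open>v - w\<close>, \<open>w\<close> are the differences of the occurrence counts of the indices
  0, 1, 2, 3.\<close>

definition rel_size :: "int \<Rightarrow> int \<Rightarrow> int \<Rightarrow> int" where
  "rel_size u v w = \<bar>u\<bar> + \<bar>u - v\<bar> + \<bar>v - w\<bar> + \<bar>w\<bar>"

text \<open>\<open>rel_size\<close> is the length of the closed walk \<open>0, u, v, w, 0\<close>,
  hence at least twice the distance between any two of its points.\<close>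

lemma near_rel_size: "rel_size u v w \<le> 2 * q \<Longrightarrow> near q u v w"
  unfolding rel_size_def near_def by linarith

text \<open>The vector \<open>(1 - q, 1, 1 - q)\<close> is a relation of these gaps and satisfies
  \<open>near\<close>; only its \<open>rel_size\<close>, which is \<open>4 * q - 2\<close>, excludes
  it.\<close>

lemma rank_zero_model:
  fixes q u v w :: int
  assumes "2 \<le> q" "rel_size u v w \<le> 2 * q" "u + v * (q * q - 1) + w * q = 0"
  shows "u = 0 \<and> v = 0 \<and> w = 0"
proof -
  have nonpos: False if size: "rel_size u v w \<le> 2 * q"
    and eq: "u + v * (q * q - 1) + w * q = 0" and v: "0 < v" for u v w
  proof -
    have qq: "2 * q \<le> q * q" using assms(1) by (intro mult_right_mono) auto
    then have "q * q - 1 \<le> v * (q * q - 1)"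
      using v assms(1) mult_right_mono[of 1 v "q * q - 1"] by simp
    then have "- w * q \<ge> q * q - 1 - \<bar>u\<bar>" using eq by simp
    moreover have "\<bar>u\<bar> \<le> q" using near_rel_size[OF size] by (simp add: near_def)
    ultimately have "(q - 2) * q < - w * q" using assms(1) by (simp add: algebra_simps)
    then have "q - 2 < - w" using assms(1) by (subst (asm) mult_less_cancel_right) auto
    then have w: "q - 1 \<le> - w" by simp
    \<comment> \<open>The size bound gives \<open>v - w \<le> q\<close>, which leaves a single
      candidate.\<close>
    then have "v = 1" "- w = q - 1"
      using size v unfolding rel_size_def by linarith+
    then have w: "w = 1 - q" by simp
    then have "u = 1 - q" using eq unfolding w \<open>v = 1\<close> by (simp add: algebra_simps)
    then show False using size \<open>v = 1\<close> w assms(1) by (simp add: rel_size_def)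
  qed
  have "\<not> 0 < v" using nonpos[of u v w] assms by blast
  moreover have "\<not> v < 0"
  proof
    assume "v < 0"
    have "rel_size (- u) (- v) (- w) = rel_size u v w" by (simp add: rel_size_def)
    moreover have "- u + - v * (q * q - 1) + - w * q = - (u + v * (q * q - 1) + w * q)" by simp
    ultimately show False using nonpos[of "- u" "- v" "- w"] assms \<open>v < 0\<close> by simp
  qed
  ultimately have v: "v = 0" by simp
  then have u: "u = - w * q" using assms by simp
  have "\<bar>u\<bar> \<le> q" using near_rel_size[OF assms(2)] by (simp add: near_def)
  then have "\<bar>w\<bar> * q \<le> 1 * q" using u assms(1) by (simp add: abs_mult)
  then have "\<bar>w\<bar> \<le> 1" using assms(1) mult_le_cancel_right_pos[of q "\<bar>w\<bar>" 1] by simp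
  then have "w = 0 \<or> w = 1 \<or> w = - 1" by linarith
  then show ?thesis using u v assms(1,2) by (auto simp: rel_size_def)
qed

lemma gap_model:
  fixes a b c :: real and q :: int
  assumes "0 < a" "0 < b" "0 < c" "2 \<le> q"
  shows "\<exists>A B C. 0 < A \<and> 0 < B \<and> 0 < C \<and> A + B + C \<le> q * (q + 1) \<and>
    (\<forall>u v w. rel_size u v w \<le> 2 * q \<longrightarrow> (u * a + v * b + w * c = 0 \<longleftrightarrow> u * A + v * B + w * C = 0))"
proof -
  let ?P = "\<lambda>u v w. rel_size u v w \<le> 2 * q"
  let ?rel = "\<lambda>u v w :: int. u * a + v * b + w * c = 0"
  have bound: "q * (q + 1) = q * q + q" by (simp add: algebra_simps)
  consider (zero) "\<forall>u v w. ?P u v w \<and> ?rel u v w \<longrightarrow> u = 0 \<and> v = 0 \<and> w = 0"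
    | (one) x y z where "?P x y z" "?rel x y z" "\<not> (x = 0 \<and> y = 0 \<and> z = 0)"
        "\<forall>u v w. ?P u v w \<and> ?rel u v w \<longrightarrow> u * y = v * x \<and> u * z = w * x \<and> v * z = w * y"
    | (two) x y z u v w where "?P x y z" "?rel x y z" "?P u v w" "?rel u v w"
        "\<not> (u * y = v * x \<and> u * z = w * x \<and> v * z = w * y)"
    by metis
  then show ?thesis
  proof cases
    case zero
    have "2 * q \<le> q * q" using assms(4) by (intro mult_right_mono) auto
    then have "0 < q * q - 1" using assms(4) by linarith
    moreover have "?rel u v w \<longleftrightarrow> u * 1 + v * (q * q - 1) + w * q = 0" if "?P u v w" for u v w
      using zero[rule_format, of u v w] rank_zero_model[OF assms(4) that] that by auto
    ultimately show ?thesis using assms(4)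
      by (intro exI[of _ 1] exI[of _ "q * q - 1"] exI[of _ q]) (auto simp: bound)
  next
    case one
    note r = one(1-3) and par = one(4)
    have near: "near q u v w \<and> near q u w v \<and> near q v u w \<and> near q v w u \<and> near q w u v \<and> near q w v u"
      if "?P u v w" for u v w
      using near_rel_size[OF that] by (auto simp: near_def abs_minus_commute)
    \<comment> \<open>The gaps are positive, so a nonzero relation has coefficients of both signs.
      Moving a positive one to the first place and a negative one to the second gives the six cases
      below.\<close>
    have "(0 < x \<or> 0 < y \<or> 0 < z) \<and> (x < 0 \<or> y < 0 \<or> z < 0)"
    proof (rule ccontr)
      assume "\<not> ?thesis"
      then consider "0 \<le> x \<and> 0 \<le> y \<and> 0 \<le> z" | "x \<le> 0 \<and> y \<le> 0 \<and> z \<le> 0" by linarith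
      then show False
      proof cases
        case 1
        then have "0 \<le> x * a" "0 \<le> y * b" "0 \<le> z * c" using assms by simp_all
        then have "x * a = 0" "y * b = 0" "z * c = 0" using r(2) by linarith+
        then show False using r(3) assms by simp
      next
        case 2
        then have "x * a \<le> 0" "y * b \<le> 0" "z * c \<le> 0"
          using assms by (simp_all add: mult_nonpos_nonneg)
        then have "x * a = 0" "y * b = 0" "z * c = 0" using r(2) by linarith+
        then show False using r(3) assms by simp
      qed
    qed
    then consider "0 < x" "y < 0" | "0 < x" "z < 0" | "0 < y" "x < 0" | "0 < y" "z < 0"
      | "0 < z" "x < 0" | "0 < z" "y < 0" by linarith
    then show ?thesis
    proof cases
      case 1
      obtain A B C where "0 < A" "0 < B" "0 < C" "A + B + C \<le> q * q + q"
        "\<forall>u v w. ?P u v w \<longrightarrow> (u * a + v * b + w * c = 0 \<longleftrightarrow> u * A + v * B + w * C = 0)"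
        using rank_one_model[of "\<lambda>u v w. ?P u v w" q "x" "- y" "z" a b c]
          r(1,2) par near 1 by (auto simp: algebra_simps)
      then show ?thesis unfolding bound
        by (intro exI[of _ A] exI[of _ B] exI[of _ C]) (auto simp: algebra_simps)
    next
      case 2
      obtain A B C where "0 < A" "0 < B" "0 < C" "A + B + C \<le> q * q + q"
        "\<forall>u v w. ?P u w v \<longrightarrow> (u * a + v * c + w * b = 0 \<longleftrightarrow> u * A + v * B + w * C = 0)"
        using rank_one_model[of "\<lambda>u v w. ?P u w v" q "x" "- z" "y" a c b]
          r(1,2) par near 2 by (auto simp: algebra_simps)
      then show ?thesis unfolding bound
        by (intro exI[of _ A] exI[of _ C] exI[of _ B]) (auto simp: algebra_simps)
    next
      case 3
      obtain A B C where "0 < A" "0 < B" "0 < C" "A + B + C \<le> q * q + q"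
        "\<forall>u v w. ?P v u w \<longrightarrow> (u * b + v * a + w * c = 0 \<longleftrightarrow> u * A + v * B + w * C = 0)"
        using rank_one_model[of "\<lambda>u v w. ?P v u w" q "y" "- x" "z" b a c]
          r(1,2) par near 3 by (auto simp: algebra_simps)
      then show ?thesis unfolding bound
        by (intro exI[of _ B] exI[of _ A] exI[of _ C]) (auto simp: algebra_simps)
    next
      case 4
      obtain A B C where "0 < A" "0 < B" "0 < C" "A + B + C \<le> q * q + q"
        "\<forall>u v w. ?P w u v \<longrightarrow> (u * b + v * c + w * a = 0 \<longleftrightarrow> u * A + v * B + w * C = 0)"
        using rank_one_model[of "\<lambda>u v w. ?P w u v" q "y" "- z" "x" b c a]
          r(1,2) par near 4 by (auto simp: algebra_simps)
      then show ?thesis unfolding bound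
        by (intro exI[of _ C] exI[of _ A] exI[of _ B]) (auto simp: algebra_simps)
    next
      case 5
      obtain A B C where "0 < A" "0 < B" "0 < C" "A + B + C \<le> q * q + q"
        "\<forall>u v w. ?P v w u \<longrightarrow> (u * c + v * a + w * b = 0 \<longleftrightarrow> u * A + v * B + w * C = 0)"
        using rank_one_model[of "\<lambda>u v w. ?P v w u" q "z" "- x" "y" c a b]
          r(1,2) par near 5 by (auto simp: algebra_simps)
      then show ?thesis unfolding bound
        by (intro exI[of _ B] exI[of _ C] exI[of _ A]) (auto simp: algebra_simps)
    next
      case 6
      obtain A B C where "0 < A" "0 < B" "0 < C" "A + B + C \<le> q * q + q"
        "\<forall>u v w. ?P w v u \<longrightarrow> (u * c + v * b + w * a = 0 \<longleftrightarrow> u * A + v * B + w * C = 0)"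
        using rank_one_model[of "\<lambda>u v w. ?P w v u" q "z" "- y" "x" c b a]
          r(1,2) par near 6 by (auto simp: algebra_simps)
      then show ?thesis unfolding bound
        by (intro exI[of _ C] exI[of _ B] exI[of _ A]) (auto simp: algebra_simps)
    qed
  next
    case two
    have "q * q \<le> q * (q + 1)" using assms(4) by simp
    then show ?thesis
      using rank_two_model[OF assms(1-3) near_rel_size[OF two(1)] near_rel_size[OF two(3)] two(2,4,5)]
      by (meson order_trans)
  qed
qed

section \<open>From index lists to relations between gaps\<close>

text \<open>Summation by parts: each gap is counted once for every index beyond it. The general ring
  covers both the real alphabet and the integer model.\<close>

lemma sum_index_list:
  fixes f :: "nat \<Rightarrow> 'a :: comm_ring_1"
  assumes "\<forall>i \<in> set I. i < 4"
  shows "(\<Sum>\<nu><length I. f (I ! \<nu>)) = of_nat (length I) * f 0 +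
    of_int (int (count_list I 1) + int (count_list I 2) + int (count_list I 3)) * (f 1 - f 0) +
    of_int (int (count_list I 2) + int (count_list I 3)) * (f 2 - f 1) +
    of_int (int (count_list I 3)) * (f 3 - f 2)"
  using assms
proof (induction I)
  case (Cons i I)
  have "i = 0 \<or> i = 1 \<or> i = 2 \<or> i = 3" using Cons.prems by auto
  then show ?case
    using Cons.IH Cons.prems
    by (auto simp: sum.lessThan_Suc_shift algebra_simps simp del: sum.lessThan_Suc)
qed simp

lemma length_index_list:
  assumes "\<forall>i \<in> set I. i < 4"
  shows "length I = count_list I 0 + count_list I 1 + count_list I 2 + count_list I (3::nat)"
  using assms
proof (induction I)
  case (Cons i I)
  have "i = 0 \<or> i = 1 \<or> i = 2 \<or> i = 3" using Cons.prems by auto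
  then show ?case using Cons by auto
qed simp

lemma integer_model_from_gaps:
  fixes t0 t1 t2 t3 :: real and A B C :: int
  assumes pos: "0 < A" "0 < B" "0 < C"
    and rels: "\<And>u v w. rel_size u v w \<le> 2 * int q \<Longrightarrow>
      u * (t1 - t0) + v * (t2 - t1) + w * (t3 - t2) = 0 \<longleftrightarrow> u * A + v * B + w * C = 0"
  shows "integer_model q [t0, t1, t2, t3] [0, A, A + B, A + B + C]"
  unfolding integer_model_def
proof (intro conjI allI impI)
  let ?T = "[t0, t1, t2, t3]" and ?S = "[0, A, A + B, A + B + C]"
  fix h I J
  assume h: "1 \<le> h \<and> h \<le> q"
    and "index_list (length ?T) h I \<and> index_list (length ?T) h J"
  then have I: "length I = h" "\<forall>i \<in> set I. i < 4" and J: "length J = h" "\<forall>i \<in> set J. i < 4"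
    by (auto simp: index_list_def)
  \<comment> \<open>These are the differences of the tail counts. Equal lengths make
    \<open>- u\<close> the count difference at index 0, and the four differences have absolute
    values adding up to at most \<open>2 * h\<close>.\<close>
  define w where "w = int (count_list I 3) - int (count_list J 3)"
  define v where "v = int (count_list I 2) - int (count_list J 2) + w"
  define u where "u = int (count_list I 1) - int (count_list J 1) + v"
  have "rel_size u v w \<le> 2 * int q"
    using length_index_list[OF I(2)] length_index_list[OF J(2)] I(1) J(1) h
    unfolding rel_size_def u_def v_def w_def by linarith
  note rels = rels[OF this]
  have "(\<Sum>\<nu><h. ?T ! (I ! \<nu>)) - (\<Sum>\<nu><h. ?T ! (J ! \<nu>))
      = u * (t1 - t0) + v * (t2 - t1) + w * (t3 - t2)"
    using sum_index_list[OF I(2), of "(!) ?T"] sum_index_list[OF J(2), of "(!) ?T"] I(1) J(1)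
    by (simp add: u_def v_def w_def algebra_simps numeral_eq_Suc)
  moreover have "(\<Sum>\<nu><h. ?S ! (I ! \<nu>)) - (\<Sum>\<nu><h. ?S ! (J ! \<nu>)) = u * A + v * B + w * C"
    using sum_index_list[OF I(2), of "(!) ?S"] sum_index_list[OF J(2), of "(!) ?S"] I(1) J(1)
    by (simp add: u_def v_def w_def algebra_simps numeral_eq_Suc)
  ultimately show "(\<Sum>\<nu><h. ?T ! (I ! \<nu>)) = (\<Sum>\<nu><h. ?T ! (J ! \<nu>)) \<longleftrightarrow>
      (\<Sum>\<nu><h. ?S ! (I ! \<nu>)) = (\<Sum>\<nu><h. ?S ! (J ! \<nu>))"
    using rels by (metis eq_iff_diff_eq_0)
qed (use pos in auto)

lemma length_4_elems:
  assumes "length xs = 4"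
  obtains a b c d where "xs = [a, b, c, d]"
  using assms by (auto simp: numeral_eq_Suc length_Suc_conv)

lemma exists_model:
  assumes "2 \<le> q" "ordered_alphabet 4 T"
  shows "\<exists>S. integer_model q T S \<and> diameter S \<le> int q * (int q + 1)"
proof -
  obtain t0 t1 t2 t3 where T: "T = [t0, t1, t2, t3]"
    using assms length_4_elems by (metis ordered_alphabet_def)
  then have "0 < t1 - t0" "0 < t2 - t1" "0 < t3 - t2"
    using assms by (auto simp: ordered_alphabet_def)
  then obtain A B C where S: "0 < A" "0 < B" "0 < C" "A + B + C \<le> int q * (int q + 1)"
    "\<And>u v w. rel_size u v w \<le> 2 * int q \<Longrightarrow>
      u * (t1 - t0) + v * (t2 - t1) + w * (t3 - t2) = 0 \<longleftrightarrow> u * A + v * B + w * C = 0"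
    using gap_model[of "t1 - t0" "t2 - t1" "t3 - t2" "int q"] assms(1) by auto
  show ?thesis
    using integer_model_from_gaps[OF S(1-3,5)] S(4) unfolding T
    by (intro exI[of _ "[0, A, A + B, A + B + C]"]) (simp add: diameter_def)
qed

section \<open>An alphabet attaining the bound\<close>

lemma extremal_alphabet_diameter_ge:
  fixes q :: nat
  defines "T \<equiv> [0, 1, real q + 1, real q * (real q + 1)]"
  assumes q: "2 \<le> q" and model: "integer_model q T S"
  shows "int q * (int q + 1) \<le> diameter S"
proof -
  have "length S = 4" using model by (simp add: integer_model_def T_def)
  then obtain s0 s1 s2 s3 where S: "S = [s0, s1, s2, s3]" by (rule length_4_elems)
  have less: "s0 < s1" "s1 < s2" using model by (auto simp: integer_model_def S)
  have coincide: "(\<Sum>i\<leftarrow>I. T ! i) = (\<Sum>i\<leftarrow>J. T ! i) \<longleftrightarrow> (\<Sum>i\<leftarrow>I. S ! i) = (\<Sum>i\<leftarrow>J. S ! i)"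
    if "1 \<le> length I" "length I \<le> q" "length J = length I" "set I \<subseteq> {..<4}" "set J \<subseteq> {..<4}" for I J
  proof -
    have "index_list (length T) (length I) I" "index_list (length T) (length I) J"
      using that by (auto simp: index_list_def T_def)
    then show ?thesis
      using model that unfolding integer_model_def
      by (simp add: sum_list_sum_nth atLeast0LessThan)
  qed
  \<comment> \<open>In \<open>T\<close>, \<open>q\<close> copies of \<open>q + 1\<close> have the
    same sum as \<open>q * (q + 1)\<close> and \<open>q - 1\<close> zeros.\<close>
  have "(\<Sum>i\<leftarrow>replicate q 2. S ! i) = (\<Sum>i\<leftarrow>3 # replicate (q - 1) 0. S ! i)"
    by (subst coincide [symmetric]) (use q in \<open>auto simp: T_def sum_list_replicate\<close>)
  then have "int q * s2 = s3 + (int q - 1) * s0"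
    using q by (simp add: S sum_list_replicate of_nat_diff)
  then have diam: "diameter S = int q * (s2 - s0)"
    by (simp add: diameter_def S algebra_simps)
  have "int q < s2 - s0"
  proof (rule ccontr)
    assume small: "\<not> int q < s2 - s0"
    define A where "A = nat (s1 - s0)"
    define B where "B = nat (s2 - s1)"
    have AB: "0 < A" "0 < B" "A + B \<le> q" "s1 = s0 + A" "s2 = s0 + A + B"
      using less small by (auto simp: A_def B_def)
    \<comment> \<open>The point \<open>s1\<close> divides the interval from \<open>s0\<close> to
      \<open>s2\<close> in the ratio \<open>A : B\<close>, so the sums agree in \<open>S\<close>.
      The lists have length \<open>A + B \<le> q\<close>, so the coincidence transfers to
      \<open>T\<close>.\<close>
    have "(\<Sum>i\<leftarrow>replicate (A + B) 1. T ! i) = (\<Sum>i\<leftarrow>replicate B 0 @ replicate A 2. T ! i)"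
      by (subst coincide) (use AB in \<open>auto simp: S sum_list_replicate algebra_simps\<close>)
    then have "real (A * q) = real B" by (simp add: T_def sum_list_replicate algebra_simps)
    then have "A * q = B" by (simp only: of_nat_eq_iff)
    moreover have "1 * q \<le> A * q" using AB by (intro mult_right_mono) auto
    ultimately show False using AB by linarith
  qed
  then show ?thesis unfolding diam by (intro mult_left_mono) auto
qed

theorem theorem1:
  "(\<forall>q::nat. q \<ge> 2 \<longrightarrow> H 4 q = int q * (int q + 1)) \<and> H 4 1 = 3"
proof (intro conjI allI impI)
  fix q :: nat
  assume q: "2 \<le> q"
  show "H 4 q = int q * (int q + 1)"
    unfolding H_def
  proof (rule Least_equality)
    show "\<forall>T. ordered_alphabet 4 T \<longrightarrow> (\<exists>S. integer_model q T S \<and> diameter S \<le> int q * (int q + 1))"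
      using exists_model[OF q] by blast
  next
    fix D
    assume D: "\<forall>T. ordered_alphabet 4 T \<longrightarrow> (\<exists>S. integer_model q T S \<and> diameter S \<le> D)"
    define d where "d = real q * (real q + 1)"
    have "1 * (real q + 1) < d"
      unfolding d_def using q by (intro mult_strict_right_mono) auto
    then have "ordered_alphabet 4 [0, 1, real q + 1, d]"
      using q by (simp add: ordered_alphabet_def)
    then obtain S where "integer_model q [0, 1, real q + 1, d] S" "diameter S \<le> D"
      using D by blast
    then show "int q * (int q + 1) \<le> D" using extremal_alphabet_diameter_ge[OF q] unfolding d_def by fastforce
  qed
next
  show "H 4 1 = 3"
    unfolding H_def
  proof (rule Least_equality)
    show "\<forall>T. ordered_alphabet 4 T \<longrightarrow> (\<exists>S. integer_model 1 T S \<and> diameter S \<le> 3)"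
    proof (intro allI impI)
      fix T
      assume T: "ordered_alphabet 4 T"
      have T': "distinct T" "length T = 4"
        using T by (auto simp: ordered_alphabet_def strict_sorted_iff)
      \<comment> \<open>Only lists of length 1 are compared, and distinctness reduces either
        equality to equality of positions.\<close>
      have "integer_model 1 T [0, 1, 2, 3]"
        unfolding integer_model_def
      proof (intro conjI allI impI)
        fix h I J
        assume "1 \<le> h \<and> h \<le> (1 :: nat)"
          and "index_list (length T) h I \<and> index_list (length T) h J"
        then have h: "h = 1" and IJ: "length I = 1" "I ! 0 < 4" "length J = 1" "J ! 0 < 4"
          using T' by (auto simp: index_list_def)
        have "distinct [0, 1, 2, 3 :: int]" "length [0, 1, 2, 3 :: int] = 4" by simp_all
        then have "[0, 1, 2, 3 :: int] ! (I ! 0) = [0, 1, 2, 3] ! (J ! 0) \<longleftrightarrow> I ! 0 = J ! 0"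
          using IJ by (simp only: nth_eq_iff_index_eq)
        moreover have "T ! (I ! 0) = T ! (J ! 0) \<longleftrightarrow> I ! 0 = J ! 0"
          using IJ T' by (simp add: nth_eq_iff_index_eq)
        ultimately show "(\<Sum>\<nu><h. T ! (I ! \<nu>)) = (\<Sum>\<nu><h. T ! (J ! \<nu>)) \<longleftrightarrow>
            (\<Sum>\<nu><h. [0, 1, 2, 3 :: int] ! (I ! \<nu>)) = (\<Sum>\<nu><h. [0, 1, 2, 3] ! (J ! \<nu>))"
          unfolding h by (simp del: nth_Cons_0)
      qed (use T' in auto)
      then show "\<exists>S. integer_model 1 T S \<and> diameter S \<le> 3"
        by (intro exI[of _ "[0, 1, 2, 3]"]) (simp add: diameter_def)
    qed
  next
    fix D
    assume "\<forall>T. ordered_alphabet 4 T \<longrightarrow> (\<exists>S. integer_model 1 T S \<and> diameter S \<le> D)"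
    moreover have "ordered_alphabet 4 [0, 1, 2, 3]" by (simp add: ordered_alphabet_def)
    ultimately obtain S where S: "integer_model 1 [0, 1, 2, 3] S" "diameter S \<le> D" by blast
    have "length S = 4" using S(1) by (simp add: integer_model_def)
    then obtain a b c d where "S = [a, b, c, d]" by (rule length_4_elems)
    then show "3 \<le> D" using S by (auto simp: integer_model_def diameter_def)
  qed
qed

end
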